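(* Let $n\ge2$ and let $\mathbf{X}=(X_1,\dots,X_n)$ be a random vector with joint density $g$ on $\mathbb{R}^n$. Let $T=\sqrt n\,\overline{\mathbf{X}}/S$ be the Student one-sample $t$-statistic. Suppose that $g$ is continuous, that $$g(x\mathbf{I})>0\quad\text{for some }x\ge0,$$ and that for some $\varepsilon>0$ $$\int_0^\infty r^{n-1}\sup_{\|\boldsymbol\xi\|<\varepsilon,\ \boldsymbol\xi\in L^\perp}g(r(\mathbf{I}+\boldsymbol\xi))\,dr<\infty.$$ Then $$\frac{\mathbf{P}(T>u)}{t_{n-1}(u)}=K_g+o(1)\quad\text{as }u\to\infty,\qquad\text{where}\quad K_g=\frac{2\pi^{n/2}}{\Gamma(n/2)}\int_0^\infty r^{n-1}g(r\mathbf{I})\,dr$$ and $0<K_g<\infty$.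
   Context: $\overline{\mathbf{X}}$ and $S^2$ are the sample mean and the sample variance (divisor $n-1$) of $\mathbf{X}$. $\mathbf{I}=(1/\sqrt n,\dots,1/\sqrt n)\in\mathbb{R}^n$; $L$ is the linear span of $\mathbf{I}$ and $L^\perp$ its orthogonal complement in $\mathbb{R}^n$. $t_{n-1}(u)=\mathbf{P}(\tau>u)$ is the tail of the Student $t$-distribution with $n-1$ degrees of freedom. *)

theory Defs
  imports "HOL-Probability.Probability" "HOL-Library.Landau_Symbols"
begin

definition sample_mean :: "real ^ 'n \<Rightarrow> real" where
  "sample_mean x = (\<Sum>i\<in>UNIV. x $ i) / real CARD('n)"

definition sample_variance :: "real ^ 'n \<Rightarrow> real" where
  "sample_variance x = (\<Sum>i\<in>UNIV. (x $ i - sample_mean x)\<^sup>2) / (real CARD('n) - 1)"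

(* Where the sample variance vanishes, the value is 0 by the convention x / 0 = 0. *)
definition t_statistic :: "real ^ 'n \<Rightarrow> real" where
  "t_statistic x = sqrt (real CARD('n)) * sample_mean x / sqrt (sample_variance x)"

definition diag_unit :: "real ^ 'n" where
  "diag_unit = (\<chi> i. 1 / sqrt (real CARD('n)))"

definition diag_line :: "(real ^ 'n) set" where
  "diag_line = span {diag_unit}"

(* nu is the number of degrees of freedom *)
definition student_t_density :: "real \<Rightarrow> real \<Rightarrow> real" where
  "student_t_density \<nu> x =
     Gamma ((\<nu> + 1) / 2) / (sqrt (\<nu> * pi) * Gamma (\<nu> / 2)) * (1 + x\<^sup>2 / \<nu>) powr (- (\<nu> + 1) / 2)"

definition student_t :: "real \<Rightarrow> real measure" where
  "student_t \<nu> = density lborel (\<lambda>x. ennreal (student_t_density \<nu> x))"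

definition student_t_tail :: "real \<Rightarrow> real \<Rightarrow> real" where
  "student_t_tail \<nu> u = measure (student_t \<nu>) {u<..}"

(* Extended-valued, so that finiteness of the constant is a genuine assertion. *)
definition K_const :: "(real ^ 'n \<Rightarrow> real) \<Rightarrow> ennreal" where
  "K_const g =
     ennreal (2 * pi powr (real CARD('n) / 2) / Gamma (real CARD('n) / 2)) *
     (\<integral>\<^sup>+ r \<in> {0..}. ennreal (r ^ (CARD('n) - 1) * g (r *\<^sub>R diag_unit)) \<partial>lborel)"

end

theory Submission
  imports Defs
begin

text \<open>
  Let \<open>e\<close> be the unit vector on the diagonal, \<open>m = n - 1\<close>, and let \<open>y\<close> be the component of \<open>x\<close> orthogonal
  to \<open>e\<close>. For \<open>u > 0\<close> the event \<open>T > u\<close> is the narrow cone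
  \<open>0 < norm y < \<delta> * (x \<bullet> e)\<close> with \<open>\<delta> = sqrt m / u\<close>. Rotating \<open>e\<close> to a coordinate axis and rescaling each slice
  \<open>x \<bullet> e = r\<close> by \<open>\<delta> * r\<close> turns its probability into \<open>\<delta>^m\<close> times the integral of \<open>r^m * g (r (e + \<delta> \<xi>))\<close>
  over \<open>r \<ge> 0\<close> and \<open>\<xi>\<close> in the \<open>m\<close>-dimensional unit ball. By dominated convergence the latter tends to the
  volume of that ball times the integral of \<open>r^m * g (r e)\<close>. Since the Student tail is asymptotic to an
  explicit multiple of \<open>u powr (-m)\<close>, the ratio converges.
\<close>

section \<open>Invariance of Lebesgue measure under orthogonal maps\<close>

text \<open>Covers translations (\<open>c = 1\<close>) and point reflections (\<open>c = -1\<close>)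
  at once: the Jacobian is a power of the absolute value of \<open>c\<close>, hence 1. The Haar
  argument below uses both.\<close>

lemma nn_integral_lborel_affine_unit:
  fixes f :: "'a::euclidean_space \<Rightarrow> ennreal"
  assumes [measurable]: "f \<in> borel_measurable borel" and "\<bar>c\<bar> = 1"
  shows "(\<integral>\<^sup>+x. f (t + c *\<^sub>R x) \<partial>lborel) = (\<integral>\<^sup>+x. f x \<partial>lborel)"
proof -
  have "c \<noteq> 0" using assms(2) by auto
  show ?thesis
    by (subst (2) lborel_affine[OF \<open>c \<noteq> 0\<close>, of t])
       (simp add: assms(2) nn_integral_density nn_integral_distr)
qed

text \<open>Uniqueness of Haar measure by Fubini: the unit ball is a test set of the same volume for both
  measures.\<close>
lemma nn_integral_lborel_orthogonal:
  fixes Q :: "'a::euclidean_space \<Rightarrow> 'a" and f :: "'a \<Rightarrow> ennreal"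
  assumes Q: "orthogonal_transformation Q" and [measurable]: "f \<in> borel_measurable borel"
  shows "(\<integral>\<^sup>+x. f (Q x) \<partial>lborel) = (\<integral>\<^sup>+x. f x \<partial>lborel)"
proof -
  define b :: "'a \<Rightarrow> ennreal" where "b = indicator (ball 0 1)"
  have [measurable]: "b \<in> borel_measurable borel" unfolding b_def by (intro borel_measurable_indicator) simp
  have lin: "linear Q" using Q by (simp add: orthogonal_transformation_def)
  have [measurable]: "Q \<in> borel_measurable borel"
    using lin by (intro borel_measurable_continuous_onI linear_continuous_on) (simp only: linear_conv_bounded_linear)
  have bQ: "b (Q x) = b x" for x
    using Q by (simp add: b_def indicator_def orthogonal_transformation_norm)
  define V where "V = (\<integral>\<^sup>+y. b y \<partial>lborel)"
  have V: "V = ennreal (unit_ball_vol DIM('a))"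
    by (simp add: V_def b_def emeasure_ball)
  \<comment> \<open>The factor \<open>V\<close> is rewritten, for each \<open>x\<close>, as the
    integral of \<open>b (Q x - y)\<close> over \<open>y\<close>; this is the reflected ball
    \<open>b\<close> centred at \<open>Q x\<close>.\<close>
  have "(\<integral>\<^sup>+x. f (Q x) \<partial>lborel) * V = (\<integral>\<^sup>+x. f (Q x) * V \<partial>lborel)"
    by (simp add: nn_integral_multc)
  also have "\<dots> = (\<integral>\<^sup>+x. \<integral>\<^sup>+y. f (Q x) * b (Q x - y) \<partial>lborel \<partial>lborel)"
    using nn_integral_lborel_affine_unit[of b "-1"]
    by (intro nn_integral_cong) (simp add: nn_integral_cmult V_def)
  also have "\<dots> = (\<integral>\<^sup>+y. \<integral>\<^sup>+x. f (Q x) * b (Q x - y) \<partial>lborel \<partial>lborel)"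
    by (rule lborel_pair.Fubini') measurable
  also have "\<dots> = (\<integral>\<^sup>+y. \<integral>\<^sup>+x. f (y + Q x) * b x \<partial>lborel \<partial>lborel)"
  proof (rule nn_integral_cong)
    fix y :: 'a
    \<comment> \<open>For fixed \<open>y\<close>, translating \<open>x\<close> by a preimage
      \<open>z\<close> of \<open>y\<close> turns \<open>Q x - y\<close> into \<open>Q x\<close>, and
      \<open>b (Q x) = b x\<close> because \<open>Q\<close> preserves norms. After this
      \<open>Q\<close> occurs only as a shift inside \<open>f\<close>, which the integral over
      \<open>y\<close> absorbs.\<close>
    obtain z where z: "Q z = y"
      using orthogonal_transformation_surj[OF Q] by (metis surjD)
    have "(\<integral>\<^sup>+x. f (Q x) * b (Q x - y) \<partial>lborel) = (\<integral>\<^sup>+x. f (Q (z + x)) * b (Q (z + x) - y) \<partial>lborel)"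
      using nn_integral_lborel_affine_unit[of "\<lambda>x. f (Q x) * b (Q x - y)" 1 z] by simp
    also have "\<dots> = (\<integral>\<^sup>+x. f (y + Q x) * b x \<partial>lborel)"
      by (simp add: linear_add[OF lin] z bQ)
    finally show "(\<integral>\<^sup>+x. f (Q x) * b (Q x - y) \<partial>lborel) = (\<integral>\<^sup>+x. f (y + Q x) * b x \<partial>lborel)" .
  qed
  also have "\<dots> = (\<integral>\<^sup>+x. \<integral>\<^sup>+y. f (y + Q x) * b x \<partial>lborel \<partial>lborel)"
    by (rule lborel_pair.Fubini') measurable
  also have "\<dots> = (\<integral>\<^sup>+x. (\<integral>\<^sup>+y. f y \<partial>lborel) * b x \<partial>lborel)"
  proof (intro nn_integral_cong)
    fix x :: 'a
    show "(\<integral>\<^sup>+y. f (y + Q x) * b x \<partial>lborel) = (\<integral>\<^sup>+y. f y \<partial>lborel) * b x"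
      using nn_integral_lborel_affine_unit[of f 1 "Q x"]
      by (simp add: nn_integral_multc add.commute)
  qed
  also have "\<dots> = (\<integral>\<^sup>+y. f y \<partial>lborel) * V"
    by (simp add: nn_integral_cmult V_def)
  finally have "(\<integral>\<^sup>+x. f (Q x) \<partial>lborel) * V / V = (\<integral>\<^sup>+y. f y \<partial>lborel) * V / V"
    by simp
  \<comment> \<open>Cancelling in \<open>ennreal\<close> requires the test volume to be neither zero
    nor infinite.\<close>
  moreover have "V \<noteq> 0" "V \<noteq> \<top>"
    using unit_ball_vol_pos[of "real DIM('a)"] by (auto simp: V simp del: unit_ball_vol_pos)
  ultimately show ?thesis
    by (simp add: ennreal_mult_divide_eq)
qed

section \<open>Scaling in product spaces and splitting off one direction\<close>

text \<open>Induction on \<open>J\<close>: Fubini separates one coordinate, the one-dimensional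
  substitution contributes one factor \<open>c\<close>, and the induction hypothesis supplies the
  others. The scaled point is restricted to \<open>J\<close> so that it stays in the extensional
  function space underlying \<open>Pi\<^sub>M\<close>.\<close>

lemma nn_integral_PiM_lborel_scale:
  fixes f :: "('i \<Rightarrow> real) \<Rightarrow> ennreal"
  assumes "finite J" and c: "c > 0" and "f \<in> borel_measurable (Pi\<^sub>M J (\<lambda>_. lborel))"
  shows "(\<integral>\<^sup>+y. f y \<partial>Pi\<^sub>M J (\<lambda>_. lborel)) =
    ennreal (c ^ card J) * (\<integral>\<^sup>+y. f (\<lambda>j\<in>J. c * y j) \<partial>Pi\<^sub>M J (\<lambda>_. lborel))"
  using assms(1,3)
proof (induction J arbitrary: f)
  case empty
  then show ?case by (simp add: PiM_empty nn_integral_count_space_finite)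
next
  case (insert i J)
  interpret product_sigma_finite "\<lambda>_::'i. lborel :: real measure"
    by standard
  interpret J: finite_product_sigma_finite "\<lambda>_::'i. lborel :: real measure" J
    by standard (rule insert.hyps)
  note [measurable] = insert.prems
  have "(\<lambda>y. \<lambda>j\<in>insert i J. c * y j) \<in> Pi\<^sub>M (insert i J) (\<lambda>_. lborel) \<rightarrow>\<^sub>M Pi\<^sub>M (insert i J) (\<lambda>_. lborel)"
    by measurable
  then have m [measurable]: "(\<lambda>y. f (\<lambda>j\<in>insert i J. c * y j)) \<in> borel_measurable (Pi\<^sub>M (insert i J) (\<lambda>_. lborel))"
    by measurable
  have "(\<integral>\<^sup>+y. f y \<partial>Pi\<^sub>M (insert i J) (\<lambda>_. lborel))
      = (\<integral>\<^sup>+y. \<integral>\<^sup>+x. f (x(i := y)) \<partial>Pi\<^sub>M J (\<lambda>_. lborel) \<partial>lborel)"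
    using insert by (intro product_nn_integral_insert_rev) auto
  also have "\<dots> = (\<integral>\<^sup>+y. ennreal (c ^ card J) * (\<integral>\<^sup>+x. f ((\<lambda>j\<in>J. c * x j)(i := y)) \<partial>Pi\<^sub>M J (\<lambda>_. lborel)) \<partial>lborel)"
    by (intro nn_integral_cong insert.IH) measurable
  also have "\<dots> = ennreal (c ^ card J) * (\<integral>\<^sup>+y. (\<integral>\<^sup>+x. f ((\<lambda>j\<in>J. c * x j)(i := y)) \<partial>Pi\<^sub>M J (\<lambda>_. lborel)) \<partial>lborel)"
    by (intro nn_integral_cmult) measurable
  also have "\<dots> = ennreal (c ^ card J) * (ennreal c * (\<integral>\<^sup>+y. (\<integral>\<^sup>+x. f ((\<lambda>j\<in>J. c * x j)(i := c * y)) \<partial>Pi\<^sub>M J (\<lambda>_. lborel)) \<partial>lborel))"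
    using c by (subst nn_integral_real_affine[where c=c and t=0]) auto
  also have "(\<integral>\<^sup>+y. (\<integral>\<^sup>+x. f ((\<lambda>j\<in>J. c * x j)(i := c * y)) \<partial>Pi\<^sub>M J (\<lambda>_. lborel)) \<partial>lborel) =
     (\<integral>\<^sup>+y. (\<integral>\<^sup>+x. f (\<lambda>j\<in>insert i J. c * (x(i := y)) j) \<partial>Pi\<^sub>M J (\<lambda>_. lborel)) \<partial>lborel)"
    using insert.hyps
    by (intro nn_integral_cong arg_cong[where f=f]) (auto simp: fun_eq_iff restrict_def)
  also have "\<dots> = (\<integral>\<^sup>+y. f (\<lambda>j\<in>insert i J. c * y j) \<partial>Pi\<^sub>M (insert i J) (\<lambda>_. lborel))"
    using insert m by (intro product_nn_integral_insert_rev[symmetric]) auto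
  finally show ?case
    unfolding card_insert_disjoint[OF insert.hyps]
    by (simp only: power_Suc ennreal_mult'[OF less_imp_le[OF c]] ac_simps)
qed

lemma norm_sum_Basis_eq_L2_set:
  fixes J :: "'a::euclidean_space set"
  assumes "J \<subseteq> Basis"
  shows "norm (\<Sum>j\<in>J. y j *\<^sub>R j) = L2_set y J"
proof -
  have "(\<Sum>j\<in>J. y j *\<^sub>R j) = (\<Sum>j\<in>Basis. (if j \<in> J then y j else 0) *\<^sub>R j)"
    using assms by (intro sum.mono_neutral_cong_left) auto
  then have "norm (\<Sum>j\<in>J. y j *\<^sub>R j) = L2_set (\<lambda>j. if j \<in> J then y j else 0) Basis"
    by (simp only: norm_eq_sqrt_inner) (subst euclidean_inner, simp add: L2_set_def power2_eq_square)
  also have "\<dots> = L2_set y J"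
    unfolding L2_set_def using assms
    by (intro arg_cong[where f=sqrt] sum.mono_neutral_cong_right) auto
  finally show ?thesis .
qed

text \<open>An orthogonal map \<open>Q\<close> carries a basis vector \<open>b\<close> to
  \<open>e\<close> and preserves Lebesgue measure, so the coordinate along \<open>b\<close> becomes
  the component along \<open>e\<close>. The hyperplane orthogonal to \<open>e\<close> is
  parametrised by functions on the remaining basis vectors \<open>J\<close>, which makes its
  Lebesgue measure a finite product to which Fubini and the scaling lemma apply.\<close>

lemma lborel_orthogonal_split:
  fixes e :: "real ^ 'n"
  assumes "norm e = 1"
  obtains J :: "(real ^ 'n) set" and \<phi> :: "(real ^ 'n \<Rightarrow> real) \<Rightarrow> real ^ 'n"
  where "finite J" "card J = CARD('n) - 1" "\<phi> \<in> borel_measurable (Pi\<^sub>M J (\<lambda>_. lborel))"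
    "\<And>c y. \<phi> (\<lambda>j\<in>J. c * y j) = c *\<^sub>R \<phi> y" "\<And>y. norm (\<phi> y) = L2_set y J" "\<And>y. e \<bullet> \<phi> y = 0"
    "\<And>f::real ^ 'n \<Rightarrow> ennreal. f \<in> borel_measurable borel \<Longrightarrow>
      (\<integral>\<^sup>+x. f x \<partial>lborel) = (\<integral>\<^sup>+r. \<integral>\<^sup>+y. f (r *\<^sub>R e + \<phi> y) \<partial>Pi\<^sub>M J (\<lambda>_. lborel) \<partial>lborel)"
proof -
  obtain b :: "real ^ 'n" where b: "b \<in> Basis" using nonempty_Basis by blast
  obtain Q where Q: "orthogonal_transformation Q" "Q b = e"
    by (rule orthogonal_transformation_exists_1[OF norm_Basis[OF b] assms])
  have lin: "linear Q" using Q by (simp add: orthogonal_transformation_def)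
  have [measurable]: "Q \<in> borel_measurable borel"
    using lin by (intro borel_measurable_continuous_onI linear_continuous_on) (simp only: linear_conv_bounded_linear)
  define J where "J = Basis - {b}"
  define \<phi> where "\<phi> y = Q (\<Sum>j\<in>J. y j *\<^sub>R j)" for y :: "real ^ 'n \<Rightarrow> real"
  have J: "finite J" "J \<subseteq> Basis" "insert b J = Basis" "b \<notin> J"
    using b by (auto simp: J_def)
  have [measurable]: "\<phi> \<in> borel_measurable (Pi\<^sub>M J (\<lambda>_. lborel))"
    unfolding \<phi>_def by measurable
  show thesis
  proof (rule that[of J \<phi>])
    show "card J = CARD('n) - 1"
      using b by (simp add: J_def card_Diff_singleton)
    show "\<phi> (\<lambda>j\<in>J. c * y j) = c *\<^sub>R \<phi> y" for c y
      by (simp add: \<phi>_def linear_scale[OF lin, symmetric] scaleR_sum_right)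
    show "norm (\<phi> y) = L2_set y J" for y
      unfolding \<phi>_def orthogonal_transformation_norm[OF Q(1)] by (rule norm_sum_Basis_eq_L2_set) fact
    show "e \<bullet> \<phi> y = 0" for y
    proof -
      have "e \<bullet> \<phi> y = b \<bullet> (\<Sum>j\<in>J. y j *\<^sub>R j)"
        using Q by (simp add: \<phi>_def orthogonal_transformation_def flip: Q(2))
      also have "\<dots> = 0"
        unfolding inner_sum_right using b J
        by (intro sum.neutral) (auto simp: J_def inner_Basis)
      finally show ?thesis .
    qed
    fix f :: "real ^ 'n \<Rightarrow> ennreal"
    assume [measurable]: "f \<in> borel_measurable borel"
    interpret product_sigma_finite "\<lambda>_::real ^ 'n. lborel :: real measure"
      by standard
    have "(\<integral>\<^sup>+x. f x \<partial>lborel) = (\<integral>\<^sup>+x. f (Q x) \<partial>lborel)"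
      by (simp add: nn_integral_lborel_orthogonal[OF Q(1)])
    also have "\<dots> = (\<integral>\<^sup>+y. f (Q (\<Sum>j\<in>Basis. y j *\<^sub>R j)) \<partial>Pi\<^sub>M (insert b J) (\<lambda>_. lborel))"
      unfolding J(3) by (subst lborel_eq) (simp add: nn_integral_distr)
    also have "\<dots> = (\<integral>\<^sup>+r. \<integral>\<^sup>+y. f (Q (\<Sum>j\<in>Basis. (y(b := r)) j *\<^sub>R j)) \<partial>Pi\<^sub>M J (\<lambda>_. lborel) \<partial>lborel)"
      using J by (subst product_nn_integral_insert_rev) auto
    also have "\<dots> = (\<integral>\<^sup>+r. \<integral>\<^sup>+y. f (r *\<^sub>R e + \<phi> y) \<partial>Pi\<^sub>M J (\<lambda>_. lborel) \<partial>lborel)"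
    proof (intro nn_integral_cong arg_cong[where f=f])
      fix r y
      have "(\<Sum>j\<in>Basis. (y(b := r)) j *\<^sub>R j) = r *\<^sub>R b + (\<Sum>j\<in>J. (y(b := r)) j *\<^sub>R j)"
        using J by (subst J(3)[symmetric], subst sum.insert) auto
      also have "(\<Sum>j\<in>J. (y(b := r)) j *\<^sub>R j) = (\<Sum>j\<in>J. y j *\<^sub>R j)"
        using J by (intro sum.cong) auto
      finally show "Q (\<Sum>j\<in>Basis. (y(b := r)) j *\<^sub>R j) = r *\<^sub>R e + \<phi> y"
        by (simp add: \<phi>_def linear_add[OF lin] linear_scale[OF lin] Q)
    qed
    finally show "(\<integral>\<^sup>+x. f x \<partial>lborel) = (\<integral>\<^sup>+r. \<integral>\<^sup>+y. f (r *\<^sub>R e + \<phi> y) \<partial>Pi\<^sub>M J (\<lambda>_. lborel) \<partial>lborel)" .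
  qed (use J in auto)
qed

section \<open>Integration over narrow cones\<close>

text \<open>Squeezed between closed balls, whose volumes \<open>V * r ^ card J\<close> are known:
  the set lies in the closed unit ball, and together with a small ball of radius \<open>a\<close> it
  covers the ball of radius \<open>1 - a\<close>; then \<open>a\<close> tends to 0. Nonemptiness of
  \<open>J\<close> matters, since in dimension 0 the set is empty while the ball has volume
  1.\<close>

lemma emeasure_PiM_punctured_ball:
  fixes J :: "'i set"
  assumes "finite J" "J \<noteq> {}"
  shows "emeasure (Pi\<^sub>M J (\<lambda>_. lborel)) {y \<in> space (Pi\<^sub>M J (\<lambda>_. lborel)). 0 < L2_set y J \<and> L2_set y J < 1}
    = ennreal (unit_ball_vol (real (card J)))"
proof -
  define P where "P = Pi\<^sub>M J (\<lambda>_::'i. lborel :: real measure)"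
  define V where "V = unit_ball_vol (real (card J))"
  define C where "C r = {y \<in> space P. L2_set y J \<le> r}" for r
  define A where "A = {y \<in> space P. 0 < L2_set y J \<and> L2_set y J < 1}"
  have [measurable]: "(\<lambda>y. L2_set y J) \<in> borel_measurable P"
    unfolding L2_set_def P_def by measurable
  have mC [measurable]: "C r \<in> sets P" for r unfolding C_def by measurable
  have mA [measurable]: "A \<in> sets P" unfolding A_def by measurable
  have C: "emeasure P (C r) = ennreal (V * r ^ card J)" if "r > 0" for r
    using emeasure_cball_aux[OF assms(1) that]
    by (simp add: C_def P_def V_def L2_set_def Int_def conj_commute)
  have le: "emeasure P A \<le> ennreal V"
  proof -
    have "A \<subseteq> C 1" by (auto simp: A_def C_def)
    from emeasure_mono[OF this mC] show ?thesis using C[of 1] by simp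
  qed
  then obtain m where m: "emeasure P A = ennreal m" "m \<ge> 0"
    by (metis ennreal_cases ennreal_less_top less_le_not_le)
  have V0: "V > 0" by (simp add: V_def)
  have card: "card J > 0" using assms by (simp add: card_gt_0_iff)
  have "V * (1 - a) ^ card J \<le> V * a ^ card J + m" if a: "0 < a" "a < 1" for a
  proof -
    have "emeasure P (C (1 - a)) \<le> emeasure P (C a \<union> A)"
      using a by (intro emeasure_mono) (auto simp: C_def A_def mC[unfolded C_def] mA[unfolded A_def])
    also have "\<dots> \<le> emeasure P (C a) + emeasure P A"
      by (rule emeasure_subadditive) auto
    finally show ?thesis
      using a m V0 by (simp add: C flip: ennreal_plus)
  qed
  then have "eventually (\<lambda>a. V * (1 - a) ^ card J \<le> V * a ^ card J + m) (at_right 0)"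
    by (auto simp: eventually_at_right_field intro!: exI[of _ 1])
  moreover have "((\<lambda>a. V * (1 - a) ^ card J) \<longlongrightarrow> V * (1 - 0) ^ card J) (at_right 0)"
    by (intro tendsto_intros)
  moreover have "((\<lambda>a. V * a ^ card J + m) \<longlongrightarrow> V * 0 ^ card J + m) (at_right 0)"
    by (intro tendsto_intros)
  ultimately have "V * (1 - 0) ^ card J \<le> V * 0 ^ card J + m"
    by (intro tendsto_le[of "at_right 0"]) auto
  \<comment> \<open>The small ball disappears in the limit because \<open>0 ^ card J = 0\<close> for
    positive \<open>card J\<close>.\<close>
  then have "V \<le> m" using card by (simp add: power_0_left)
  then have "emeasure P A = ennreal V"
    using le m V0 by (intro antisym) (auto simp: ennreal_leI)
  then show ?thesis by (simp add: A_def V_def P_def)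
qed

text \<open>The measure \<open>N\<close> is Lebesgue measure on the open unit ball of the orthogonal complement
  of \<open>e\<close>; its centre is removed because the \<open>t\<close>-statistic takes a junk value on the axis.\<close>
lemma cone_nn_integral:
  fixes e :: "real ^ 'n"
  assumes "norm e = 1" "CARD('n) \<ge> 2"
  obtains N :: "(real ^ 'n) measure"
  where "sets N = sets borel"
    "emeasure N UNIV = ennreal (unit_ball_vol (real (CARD('n) - 1)))"
    "AE \<xi> in N. e \<bullet> \<xi> = 0 \<and> norm \<xi> < 1"
    "\<And>f \<delta>. f \<in> borel_measurable borel \<Longrightarrow> \<delta> > 0 \<Longrightarrow>
      (\<integral>\<^sup>+x. f x * indicator {x. 0 < x \<bullet> e \<and> x - (x \<bullet> e) *\<^sub>R e \<noteq> 0 \<and> norm (x - (x \<bullet> e) *\<^sub>R e) < \<delta> * (x \<bullet> e)} x \<partial>lborel)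
      = ennreal (\<delta> ^ (CARD('n) - 1)) *
        (\<integral>\<^sup>+r\<in>{0..}. ennreal (r ^ (CARD('n) - 1)) * (\<integral>\<^sup>+\<xi>. f (r *\<^sub>R (e + \<delta> *\<^sub>R \<xi>)) \<partial>N) \<partial>lborel)"
proof -
  obtain J :: "(real ^ 'n) set" and \<phi> :: "(real ^ 'n \<Rightarrow> real) \<Rightarrow> real ^ 'n"
    where J: "finite J" "card J = CARD('n) - 1"
    and \<phi>_meas: "\<phi> \<in> borel_measurable (Pi\<^sub>M J (\<lambda>_. lborel))"
    and \<phi>_scale: "\<And>c y. \<phi> (\<lambda>j\<in>J. c * y j) = c *\<^sub>R \<phi> y"
    and \<phi>_norm: "\<And>y. norm (\<phi> y) = L2_set y J" and \<phi>_orth: "\<And>y. e \<bullet> \<phi> y = 0"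
    and split: "\<And>f::real ^ 'n \<Rightarrow> ennreal. f \<in> borel_measurable borel \<Longrightarrow>
      (\<integral>\<^sup>+x. f x \<partial>lborel) = (\<integral>\<^sup>+r. \<integral>\<^sup>+y. f (r *\<^sub>R e + \<phi> y) \<partial>Pi\<^sub>M J (\<lambda>_. lborel) \<partial>lborel)"
    using lborel_orthogonal_split[OF assms(1)] by blast
  define P where "P = Pi\<^sub>M J (\<lambda>_::real ^ 'n. lborel :: real measure)"
  define B where "B = {\<xi>::real ^ 'n. \<xi> \<noteq> 0 \<and> norm \<xi> < 1}"
  \<comment> \<open>Product Lebesgue measure cut down to the preimage of the punctured unit ball and
    pushed forward along \<open>\<phi>\<close>; the cut is placed in the density, so integrals over
    \<open>N\<close> become integrals over \<open>P\<close>.\<close>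
  define N where "N = distr (density P (\<lambda>y. indicator B (\<phi> y))) borel \<phi>"
  define n where "n = CARD('n) - 1"
  have n: "n > 0" "card J = n" using assms J by (auto simp: n_def)
  have [measurable]: "\<phi> \<in> borel_measurable P" using \<phi>_meas by (simp add: P_def)
  have [measurable]: "B \<in> sets borel" unfolding B_def by measurable
  have N_int: "(\<integral>\<^sup>+\<xi>. f \<xi> \<partial>N) = (\<integral>\<^sup>+y. f (\<phi> y) * indicator B (\<phi> y) \<partial>P)"
    if [measurable]: "f \<in> borel_measurable borel" for f
    unfolding N_def by (simp add: nn_integral_distr nn_integral_density mult.commute)
  show thesis
  proof (rule that[of N])
    show "sets N = sets borel" by (simp add: N_def)
    have "emeasure N UNIV = (\<integral>\<^sup>+\<xi>. 1 \<partial>N)" by (simp add: N_def)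
    also have "\<dots> = (\<integral>\<^sup>+y. indicator {y \<in> space P. 0 < L2_set y J \<and> L2_set y J < 1} y \<partial>P)"
      unfolding N_int[OF borel_measurable_const]
      by (rule nn_integral_cong) (auto simp: B_def indicator_def \<phi>_norm[symmetric])
    also have "\<dots> = ennreal (unit_ball_vol (real (CARD('n) - 1)))"
    proof -
      have "J \<noteq> {}" using n by auto
      moreover have "{y \<in> space P. 0 < L2_set y J \<and> L2_set y J < 1} \<in> sets P"
        unfolding L2_set_def P_def by measurable
      ultimately show ?thesis
        using emeasure_PiM_punctured_ball[OF J(1)] by (simp add: P_def J(2))
    qed
    finally show "emeasure N UNIV = ennreal (unit_ball_vol (real (CARD('n) - 1)))" .
    show "AE \<xi> in N. e \<bullet> \<xi> = 0 \<and> norm \<xi> < 1"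
      unfolding N_def by (subst AE_distr_iff) (auto simp: AE_density \<phi>_orth B_def indicator_def intro!: AE_I2)
    fix f :: "real ^ 'n \<Rightarrow> ennreal" and \<delta> :: real
    assume [measurable]: "f \<in> borel_measurable borel" and \<delta>: "\<delta> > 0"
    define D where "D = {x. 0 < x \<bullet> e \<and> x - (x \<bullet> e) *\<^sub>R e \<noteq> 0 \<and> norm (x - (x \<bullet> e) *\<^sub>R e) < \<delta> * (x \<bullet> e)}"
    have [measurable]: "D \<in> sets borel" unfolding D_def by measurable
    have ee: "e \<bullet> e = 1" using assms(1) by (simp add: dot_square_norm)
    have D: "r *\<^sub>R e + \<phi> y \<in> D \<longleftrightarrow> 0 < r \<and> \<phi> y \<noteq> 0 \<and> norm (\<phi> y) < \<delta> * r" for r y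
    proof -
      have "(r *\<^sub>R e + \<phi> y) \<bullet> e = r"
        using \<phi>_orth[of y] by (simp add: inner_add_left ee inner_commute[of "\<phi> y"])
      then show ?thesis by (simp add: D_def)
    qed
    have "(\<integral>\<^sup>+x. f x * indicator D x \<partial>lborel)
      = (\<integral>\<^sup>+r. \<integral>\<^sup>+y. f (r *\<^sub>R e + \<phi> y) * indicator D (r *\<^sub>R e + \<phi> y) \<partial>P \<partial>lborel)"
      unfolding P_def by (rule split) measurable
    also have "\<dots> = (\<integral>\<^sup>+r. ennreal (\<delta> ^ n) * (ennreal (r ^ n) *
        (\<integral>\<^sup>+\<xi>. f (r *\<^sub>R (e + \<delta> *\<^sub>R \<xi>)) \<partial>N) * indicator {0..} r) \<partial>lborel)"
    proof (rule nn_integral_cong)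
      fix r :: real
      show "(\<integral>\<^sup>+y. f (r *\<^sub>R e + \<phi> y) * indicator D (r *\<^sub>R e + \<phi> y) \<partial>P) =
        ennreal (\<delta> ^ n) * (ennreal (r ^ n) * (\<integral>\<^sup>+\<xi>. f (r *\<^sub>R (e + \<delta> *\<^sub>R \<xi>)) \<partial>N) * indicator {0..} r)"
      proof (cases "r > 0")
        case True
        \<comment> \<open>On the slice at height \<open>r\<close> the cone is a punctured ball of
          radius \<open>\<delta> * r\<close>. Scaling by this radius turns it into \<open>B\<close>,
          and the Jacobian \<open>(\<delta> * r) ^ n\<close> yields both powers in the
          claim.\<close>
        then have c: "\<delta> * r > 0" using \<delta> by simp
        have "(\<integral>\<^sup>+y. f (r *\<^sub>R e + \<phi> y) * indicator D (r *\<^sub>R e + \<phi> y) \<partial>P) = ennreal ((\<delta> * r) ^ n) *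
          (\<integral>\<^sup>+y. f (r *\<^sub>R e + (\<delta> * r) *\<^sub>R \<phi> y) * indicator D (r *\<^sub>R e + (\<delta> * r) *\<^sub>R \<phi> y) \<partial>P)"
          unfolding P_def n(2)[symmetric] \<phi>_scale[symmetric]
          using \<open>\<phi> \<in> borel_measurable P\<close>
          by (intro nn_integral_PiM_lborel_scale J c) (simp add: P_def)
        also have "(\<integral>\<^sup>+y. f (r *\<^sub>R e + (\<delta> * r) *\<^sub>R \<phi> y) * indicator D (r *\<^sub>R e + (\<delta> * r) *\<^sub>R \<phi> y) \<partial>P)
          = (\<integral>\<^sup>+y. f (r *\<^sub>R (e + \<delta> *\<^sub>R \<phi> y)) * indicator B (\<phi> y) \<partial>P)"
        proof (rule nn_integral_cong)
          fix y
          have "r *\<^sub>R e + (\<delta> * r) *\<^sub>R \<phi> y \<in> D \<longleftrightarrow> \<phi> y \<in> B"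
            using D[of r "\<lambda>j\<in>J. (\<delta> * r) * y j"] True \<delta> by (simp add: \<phi>_scale B_def)
          then show "f (r *\<^sub>R e + (\<delta> * r) *\<^sub>R \<phi> y) * indicator D (r *\<^sub>R e + (\<delta> * r) *\<^sub>R \<phi> y)
            = f (r *\<^sub>R (e + \<delta> *\<^sub>R \<phi> y)) * indicator B (\<phi> y)"
            by (simp add: indicator_def scaleR_add_right mult.commute)
        qed
        also have "\<dots> = (\<integral>\<^sup>+\<xi>. f (r *\<^sub>R (e + \<delta> *\<^sub>R \<xi>)) \<partial>N)"
          by (subst N_int) auto
        finally show ?thesis
          using True \<delta> by (simp add: power_mult_distrib ennreal_mult' mult.assoc)
      next
        \<comment> \<open>The slice misses the cone. The indicator of \<open>{0..}\<close> still
          includes \<open>r = 0\<close>, where the right-hand side vanishes since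
          \<open>0 ^ n = 0\<close> for \<open>n > 0\<close>.\<close>
        case False
        then have "indicator D (r *\<^sub>R e + \<phi> y) = (0::ennreal)" for y
          by (simp add: D)
        then show ?thesis using False n by (auto simp: indicator_def power_0_left)
      qed
    qed
    also have "\<dots> = ennreal (\<delta> ^ n) * (\<integral>\<^sup>+r\<in>{0..}. ennreal (r ^ n) *
        (\<integral>\<^sup>+\<xi>. f (r *\<^sub>R (e + \<delta> *\<^sub>R \<xi>)) \<partial>N) \<partial>lborel)"
    proof (rule nn_integral_cmult)
      interpret P: product_sigma_finite "\<lambda>_::real ^ 'n. lborel :: real measure"
        by standard
      interpret P: finite_product_sigma_finite "\<lambda>_::real ^ 'n. lborel :: real measure" J
        by standard (rule J)
      \<comment> \<open>Measurability in \<open>r\<close> is checked on the form over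
        \<open>P\<close>, whose sigma-finiteness comes from the interpretation, and then transferred
        to the form over \<open>N\<close>.\<close>
      have meas: "(\<lambda>r. \<integral>\<^sup>+y. f (r *\<^sub>R (e + \<delta> *\<^sub>R \<phi> y)) * indicator B (\<phi> y) \<partial>P) \<in> borel_measurable lborel"
        using \<open>\<phi> \<in> borel_measurable P\<close> unfolding P_def by measurable
      have "(\<lambda>r. \<integral>\<^sup>+\<xi>. f (r *\<^sub>R (e + \<delta> *\<^sub>R \<xi>)) \<partial>N) = (\<lambda>r. \<integral>\<^sup>+y. f (r *\<^sub>R (e + \<delta> *\<^sub>R \<phi> y)) * indicator B (\<phi> y) \<partial>P)"
        by (intro ext, subst N_int) auto
      with meas have [measurable]: "(\<lambda>r. \<integral>\<^sup>+\<xi>. f (r *\<^sub>R (e + \<delta> *\<^sub>R \<xi>)) \<partial>N) \<in> borel_measurable lborel"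
        by (simp only:)
      show "(\<lambda>r. ennreal (r ^ n) * (\<integral>\<^sup>+\<xi>. f (r *\<^sub>R (e + \<delta> *\<^sub>R \<xi>)) \<partial>N) * indicator {0..} r) \<in> borel_measurable lborel"
        by measurable
    qed
    finally show "(\<integral>\<^sup>+x. f x * indicator {x. 0 < x \<bullet> e \<and> x - (x \<bullet> e) *\<^sub>R e \<noteq> 0 \<and> norm (x - (x \<bullet> e) *\<^sub>R e) < \<delta> * (x \<bullet> e)} x \<partial>lborel)
      = ennreal (\<delta> ^ (CARD('n) - 1)) *
        (\<integral>\<^sup>+r\<in>{0..}. ennreal (r ^ (CARD('n) - 1)) * (\<integral>\<^sup>+\<xi>. f (r *\<^sub>R (e + \<delta> *\<^sub>R \<xi>)) \<partial>N) \<partial>lborel)"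
      by (simp add: D_def n_def)
  qed
qed

section \<open>Asymptotics of the Student tail\<close>

text \<open>Pulling \<open>x\<^sup>2 / \<nu>\<close> out of the base isolates the pure power that
  governs the tail; the remaining factor in \<open>1 + \<nu> / x\<^sup>2\<close> tends to 1.\<close>

lemma student_t_density_eq:
  assumes "\<nu> > 0" "x > 0"
  shows "student_t_density \<nu> x =
    Gamma ((\<nu> + 1) / 2) / (sqrt (\<nu> * pi) * Gamma (\<nu> / 2)) * \<nu> powr ((\<nu> + 1) / 2)
      * (1 + \<nu> / x\<^sup>2) powr (- (\<nu> + 1) / 2) * x powr (- \<nu> - 1)"
proof -
  have "1 + x\<^sup>2 / \<nu> = (1 + \<nu> / x\<^sup>2) * (x\<^sup>2 * (1 / \<nu>))"
    using assms by (simp add: field_simps)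
  also have "\<dots> powr (- (\<nu> + 1) / 2)
      = (1 + \<nu> / x\<^sup>2) powr (- (\<nu> + 1) / 2) * (x powr (- \<nu> - 1) * \<nu> powr ((\<nu> + 1) / 2))"
  proof -
    have "x\<^sup>2 powr (- (\<nu> + 1) / 2) = x powr (- \<nu> - 1)"
    proof -
      have "x\<^sup>2 = x powr 2" using assms by (simp add: powr_numeral)
      moreover have "2 * (- (\<nu> + 1) / 2) = - \<nu> - 1" by simp
      ultimately show ?thesis by (simp only: powr_powr)
    qed
    moreover have "(1 / \<nu>) powr (- (\<nu> + 1) / 2) = \<nu> powr ((\<nu> + 1) / 2)"
    proof -
      have "1 / \<nu> = \<nu> powr (- 1)" using assms by (simp add: powr_minus_divide)
      moreover have "- 1 * (- (\<nu> + 1) / 2) = (\<nu> + 1) / 2" by simp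
      ultimately show ?thesis by (simp only: powr_powr)
    qed
    moreover have "((1 + \<nu> / x\<^sup>2) * (x\<^sup>2 * (1 / \<nu>))) powr p
        = (1 + \<nu> / x\<^sup>2) powr p * (x\<^sup>2 powr p * (1 / \<nu>) powr p)" for p
      by (simp only: powr_mult)
    ultimately show ?thesis by (simp only:)
  qed
  finally show ?thesis by (simp add: student_t_density_def)
qed

text \<open>Evaluates the two comparison integrals that bracket the Student tail; the antiderivative
  is chosen to vanish at infinity.\<close>

lemma nn_integral_powr_tail:
  assumes "\<nu> > 0" "u > (0::real)" "c \<ge> 0"
  shows "(\<integral>\<^sup>+x. ennreal (c * x powr (- \<nu> - 1)) * indicator {u..} x \<partial>lborel) = ennreal (c * u powr (- \<nu>) / \<nu>)"
proof -
  have "(\<integral>\<^sup>+x. ennreal (c * x powr (- \<nu> - 1)) * indicator {u..} x \<partial>lborel)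
      = ennreal (0 - (- c * u powr (- \<nu>) / \<nu>))"
  proof (rule nn_integral_FTC_atLeast)
    show "((\<lambda>x. - c * x powr (- \<nu>) / \<nu>) has_real_derivative c * x powr (- \<nu> - 1)) (at x)" if "u \<le> x" for x
      using that assms by (auto intro!: derivative_eq_intros)
    have "((\<lambda>x. x powr (- \<nu>)) \<longlongrightarrow> 0) at_top"
      using assms by (intro tendsto_neg_powr filterlim_ident) auto
    from tendsto_mult_right_zero[OF this, of "- c / \<nu>"]
    show "((\<lambda>x. - c * x powr (- \<nu>) / \<nu>) \<longlongrightarrow> 0) at_top" by simp
  qed (use assms in auto)
  then show ?thesis by simp
qed

text \<open>A sandwich: the correction factor \<open>c\<close> increases on the positive axis and is
  at most 1, so beyond \<open>u\<close> the density lies between \<open>B * c u\<close> and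
  \<open>B\<close> times \<open>x powr (- \<nu> - 1)\<close>. Integrating both bounds and letting
  \<open>c u\<close> tend to 1 gives the limit.\<close>

lemma student_t_tail_asymp:
  assumes "\<nu> > 0"
  shows "((\<lambda>u. u powr \<nu> * student_t_tail \<nu> u) \<longlongrightarrow>
    Gamma ((\<nu> + 1) / 2) / (sqrt (\<nu> * pi) * Gamma (\<nu> / 2)) * \<nu> powr ((\<nu> + 1) / 2) / \<nu>) at_top"
proof -
  define B where "B = Gamma ((\<nu> + 1) / 2) / (sqrt (\<nu> * pi) * Gamma (\<nu> / 2)) * \<nu> powr ((\<nu> + 1) / 2)"
  define c where "c u = (1 + \<nu> / u\<^sup>2) powr (- (\<nu> + 1) / 2)" for u
  have B: "B \<ge> 0" using assms unfolding B_def by (auto intro!: mult_nonneg_nonneg divide_nonneg_nonneg Gamma_real_nonneg)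
  have bounds: "B * c u / \<nu> \<le> u powr \<nu> * student_t_tail \<nu> u \<and> u powr \<nu> * student_t_tail \<nu> u \<le> B / \<nu>"
    if u: "u > 0" for u
  proof -
    define I where "I = (\<integral>\<^sup>+x. ennreal (student_t_density \<nu> x) * indicator {u..} x \<partial>lborel)"
    have c: "0 \<le> c u" "c x \<le> 1" for x
    proof -
      show "0 \<le> c u" by (simp add: c_def)
      have "(1 + \<nu> / x\<^sup>2) powr (- (\<nu> + 1) / 2) \<le> (1 + \<nu> / x\<^sup>2) powr 0"
        using assms by (intro powr_mono) auto
      then show "c x \<le> 1" using assms by (simp add: c_def add_nonneg_eq_0_iff)
    qed
    have cmono: "c u \<le> c x" if "u \<le> x" for x
    proof -
      have "\<nu> / x\<^sup>2 \<le> \<nu> / u\<^sup>2"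
        using that u assms by (intro divide_left_mono power_mono) auto
      then show ?thesis
        unfolding c_def using assms u that by (intro powr_mono2') (auto intro: add_pos_nonneg)
    qed
    have dens: "student_t_density \<nu> x = B * c x * x powr (- \<nu> - 1)" if "u \<le> x" for x
      using student_t_density_eq[OF assms, of x] that u by (simp add: B_def c_def)
    have "emeasure (student_t \<nu>) {u<..} = (\<integral>\<^sup>+x. ennreal (student_t_density \<nu> x) * indicator {u<..} x \<partial>lborel)"
      unfolding student_t_def by (rule emeasure_density) (auto simp: student_t_density_def)
    \<comment> \<open>Adding the endpoint \<open>u\<close> changes only a null set and gives the
      closed half-line on which the comparison integrals are computed.\<close>
    also have "\<dots> = I"
      unfolding I_def using AE_lborel_singleton[of u]
      by (intro nn_integral_cong_AE) (auto elim!: eventually_mono simp: indicator_def)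
    finally have tail: "student_t_tail \<nu> u = enn2real I"
      by (simp add: student_t_tail_def measure_def)
    have up: "I \<le> ennreal (B * u powr (- \<nu>) / \<nu>)"
      unfolding nn_integral_powr_tail[OF assms u B, symmetric] I_def
      using c B by (intro nn_integral_mono) (auto simp: indicator_def dens intro!: ennreal_leI mult_right_mono mult_left_le)
    have low: "ennreal (B * c u * u powr (- \<nu>) / \<nu>) \<le> I"
      unfolding nn_integral_powr_tail[OF assms u mult_nonneg_nonneg[OF B c(1)], symmetric] I_def
      using c B cmono by (intro nn_integral_mono) (auto simp: indicator_def dens intro!: ennreal_leI mult_right_mono mult_left_mono)
    \<comment> \<open>The upper bound makes \<open>I\<close> finite, so \<open>enn2real\<close>
      returns its true value and not the default 0.\<close>
    obtain i where i: "I = ennreal i" "i \<ge> 0"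
      using up by (metis ennreal_cases ennreal_less_top less_le_not_le top.extremum)
    have "i \<le> B * u powr (- \<nu>) / \<nu>" "B * c u * u powr (- \<nu>) / \<nu> \<le> i"
      using up low i B assms by (auto simp: ennreal_le_iff2)
    moreover have "u powr \<nu> > 0" using u by simp
    ultimately have "u powr \<nu> * i \<le> u powr \<nu> * (B * u powr (- \<nu>) / \<nu>)" "u powr \<nu> * (B * c u * u powr (- \<nu>) / \<nu>) \<le> u powr \<nu> * i"
      by (simp_all only: mult_left_mono[OF _ less_imp_le])
    moreover have "u powr \<nu> * (b * u powr (- \<nu>) / \<nu>) = b / \<nu>" for b
      using u by (simp add: powr_minus field_simps)
    ultimately show ?thesis
      using i by (simp only: tail enn2real_ennreal simp_thms)
  qed
  have "((\<lambda>u. \<nu> / u\<^sup>2) \<longlongrightarrow> 0) at_top"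
    by (intro tendsto_divide_0[OF tendsto_const] filterlim_at_top_imp_at_infinity filterlim_pow_at_top filterlim_ident) simp
  then have "((\<lambda>u. B * c u / \<nu>) \<longlongrightarrow> B * (1 + 0) powr (- (\<nu> + 1) / 2) / \<nu>) at_top"
    unfolding c_def using assms by (intro tendsto_intros) auto
  then have "((\<lambda>u. B * c u / \<nu>) \<longlongrightarrow> B / \<nu>) at_top" by simp
  moreover have "((\<lambda>u. B / \<nu>) \<longlongrightarrow> B / \<nu>) at_top" by simp
  ultimately have "((\<lambda>u. u powr \<nu> * student_t_tail \<nu> u) \<longlongrightarrow> B / \<nu>) at_top"
    by (rule tendsto_sandwich[rotated 2]) (auto intro!: eventually_mono[OF eventually_gt_at_top[of 0]] dest: bounds)
  then show ?thesis by (simp add: B_def)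
qed

text \<open>Matches the constants of the two asymptotics: the left side comes from the cone, while
  the right side is the sphere area in dimension \<open>\<nu> + 1\<close> times the limit constant
  of the Student tail. \<open>Gamma ((\<nu> + 1) / 2)\<close> cancels, the recursion of Gamma turns
  \<open>Gamma (\<nu> / 2 + 1)\<close> into \<open>\<nu> / 2 * Gamma (\<nu> / 2)\<close>, and the
  surplus half powers of \<open>\<nu>\<close> and \<open>pi\<close> cancel against
  \<open>sqrt (\<nu> * pi)\<close>.\<close>

lemma student_t_tail_constant:
  fixes \<nu> :: real
  assumes "\<nu> > 0"
  shows "sqrt \<nu> powr \<nu> * unit_ball_vol \<nu> =
    2 * pi powr ((\<nu> + 1) / 2) / Gamma ((\<nu> + 1) / 2) *
    (Gamma ((\<nu> + 1) / 2) / (sqrt (\<nu> * pi) * Gamma (\<nu> / 2)) * \<nu> powr ((\<nu> + 1) / 2) / \<nu>)"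
proof -
  have G: "Gamma (\<nu> / 2 + 1) = \<nu> / 2 * Gamma (\<nu> / 2)"
    using assms by (intro Gamma_plus1) (auto elim!: nonpos_Ints_cases)
  define a b where "a = Gamma (\<nu> / 2)" and "b = Gamma ((\<nu> + 1) / 2)"
  have pos: "a > 0" "b > 0"
    using assms by (auto simp: a_def b_def intro!: Gamma_real_pos)
  have half: "a powr ((\<nu> + 1) / 2) = a powr (\<nu> / 2) * sqrt a" if "a > 0" for a :: real
    using that by (simp add: add_divide_distrib powr_add powr_half_sqrt)
  have "sqrt \<nu> powr \<nu> = \<nu> powr (\<nu> / 2)"
    using assms by (simp add: powr_powr flip: powr_half_sqrt)
  then show ?thesis
    unfolding unit_ball_vol_def G half[OF assms] half[OF pi_gt_zero] real_sqrt_mult a_def[symmetric] b_def[symmetric]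
    using assms pos by (simp add: divide_simps)
qed

section \<open>Geometry of the t-statistic\<close>

lemma orthogonal_comp_diag_line: "(diag_line :: (real ^ 'n) set)\<^sup>\<bottom> = {\<xi>. diag_unit \<bullet> \<xi> = 0}"
  by (auto simp: orthogonal_comp_def diag_line_def span_singleton orthogonal_def)

lemma norm_diag_unit [simp]: "norm (diag_unit :: real ^ 'n) = 1"
  by (simp add: norm_eq_sqrt_inner diag_unit_def inner_vec_def flip: real_sqrt_mult)

text \<open>The component along the diagonal is \<open>sqrt n\<close> times the mean, and the
  squared norm of \<open>y\<close> is \<open>n - 1\<close> times the sample variance. Hence the
  statistic is \<open>sqrt (n - 1)\<close> times the cotangent of the angle between \<open>x\<close>
  and the diagonal, and large values mean a narrow cone.\<close>

lemma t_statistic_greater_iff: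
  fixes x :: "real ^ 'n"
  assumes "CARD('n) \<ge> 2" "u > 0"
  defines "y \<equiv> x - (x \<bullet> diag_unit) *\<^sub>R diag_unit"
  shows "t_statistic x > u \<longleftrightarrow> 0 < x \<bullet> diag_unit \<and> y \<noteq> 0
    \<and> norm y < sqrt (real CARD('n) - 1) / u * (x \<bullet> diag_unit)"
proof -
  define n where "n = real CARD('n)"
  have n: "n > 1" using assms by (simp add: n_def)
  have mean: "x \<bullet> diag_unit = sqrt n * sample_mean x"
  proof -
    have "x \<bullet> diag_unit = (\<Sum>i\<in>UNIV. x $ i) / sqrt n"
      by (simp add: inner_vec_def diag_unit_def n_def sum_divide_distrib)
    also have "\<dots> = sqrt n * ((\<Sum>i\<in>UNIV. x $ i) / (sqrt n * sqrt n))"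
      using n by (simp del: real_sqrt_mult_self)
    finally show ?thesis using n by (simp add: sample_mean_def n_def)
  qed
  have "y $ i = x $ i - sample_mean x" for i
  proof -
    have "(diag_unit :: real ^ 'n) $ i = 1 / sqrt n" by (simp add: diag_unit_def n_def)
    then show ?thesis using n by (simp add: y_def mean)
  qed
  then have "sample_variance x = (norm y)\<^sup>2 / (n - 1)"
    unfolding power2_norm_eq_inner by (simp add: sample_variance_def n_def inner_vec_def power2_eq_square)
  then have "t_statistic x = (x \<bullet> diag_unit) / (norm y / sqrt (n - 1))"
    by (simp add: t_statistic_def mean n_def[symmetric] real_sqrt_divide)
  then have t: "t_statistic x = (x \<bullet> diag_unit) * sqrt (n - 1) / norm y" by simp
  have pos: "sqrt (n - 1) > 0" using n by simp
  show ?thesis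
  proof (cases "y = 0")
    \<comment> \<open>On the axis the division by zero makes the statistic 0, which does not exceed
      the positive \<open>u\<close>; this is why the cone must exclude \<open>y = 0\<close>.\<close>
    case True
    then show ?thesis using t assms(2) by simp
  next
    case False
    then have ny: "norm y > 0" by simp
    have "t_statistic x > u \<longleftrightarrow> norm y * u < (x \<bullet> diag_unit) * sqrt (n - 1)"
      using ny by (simp add: t pos_less_divide_eq mult.commute)
    moreover have "\<dots> \<longleftrightarrow> norm y < sqrt (n - 1) / u * (x \<bullet> diag_unit)"
      using assms(2) by (simp add: pos_less_divide_eq mult.commute)
    moreover have "0 < x \<bullet> diag_unit" if "norm y < sqrt (n - 1) / u * (x \<bullet> diag_unit)"
    proof -
      have "0 < sqrt (n - 1) / u * (x \<bullet> diag_unit)" using that ny by linarith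
      then show ?thesis using pos assms(2) by (auto simp: zero_less_mult_iff zero_less_divide_iff)
    qed
    ultimately show ?thesis using False by (auto simp: n_def)
  qed
qed

section \<open>Limit of the cone integral and positivity of the ray integral\<close>

text \<open>Dominated convergence twice: over \<open>\<xi>\<close> at fixed \<open>r\<close>, with
  the constant bound \<open>w r\<close> on the finite measure \<open>N\<close>, and then over
  \<open>r\<close>, with the bound \<open>V * r ^ m * w r\<close> that \<open>fin\<close> makes
  integrable. Continuity of \<open>g\<close> gives the pointwise limits.\<close>

lemma nn_integral_cone_tendsto:
  fixes e :: "'a::euclidean_space" and g :: "'a \<Rightarrow> real"
  assumes N: "sets N = sets borel" "emeasure N UNIV = ennreal V" "AE \<xi> in N. e \<bullet> \<xi> = 0 \<and> norm \<xi> < 1"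
    and g: "continuous_on UNIV g" "\<And>x. g x \<ge> 0" and "m > 0" and "\<epsilon> > 0"
    and fin: "(\<integral>\<^sup>+r\<in>{0..}. ennreal (r ^ m) *
      (SUP \<xi>\<in>{\<xi>. e \<bullet> \<xi> = 0 \<and> norm \<xi> < \<epsilon>}. ennreal (g (r *\<^sub>R (e + \<xi>)))) \<partial>lborel) < \<infinity>"
  shows "((\<lambda>\<delta>. \<integral>\<^sup>+r\<in>{0..}. ennreal (r ^ m) * (\<integral>\<^sup>+\<xi>. ennreal (g (r *\<^sub>R (e + \<delta> *\<^sub>R \<xi>))) \<partial>N) \<partial>lborel)
    \<longlongrightarrow> ennreal V * (\<integral>\<^sup>+r\<in>{0..}. ennreal (r ^ m * g (r *\<^sub>R e)) \<partial>lborel)) (at_right 0)"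
\<comment> \<open>Dominated convergence works along sequences; taking them below
  \<open>\<epsilon>\<close> puts every term under the supremum in \<open>fin\<close>.\<close>
proof (rule tendsto_at_right_sequentially[OF \<open>\<epsilon> > 0\<close>])
  fix \<delta> :: "nat \<Rightarrow> real"
  assume \<delta>: "\<And>k. 0 < \<delta> k" "\<And>k. \<delta> k < \<epsilon>" "\<delta> \<longlonglongrightarrow> 0"
  have space [simp]: "space N = UNIV" using sets_eq_imp_space_eq[OF N(1)] by simp
  note [measurable_cong] = N(1)
  interpret N: finite_measure N by standard (simp add: N)
  have [measurable]: "g \<in> borel_measurable borel"
    using g(1) by (rule borel_measurable_continuous_onI)
  define S where "S = {\<xi>. e \<bullet> \<xi> = 0 \<and> norm \<xi> < \<epsilon>}"
  define w where "w r = (SUP \<xi>\<in>S. ennreal (g (r *\<^sub>R (e + \<xi>))))" for r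
  \<comment> \<open>The supremum is over an uncountable set, but \<open>w\<close> is lower
    semicontinuous: its strict superlevel sets are unions of open sets.\<close>
  have [measurable]: "w \<in> borel_measurable borel"
  proof (rule borel_measurableI_greater)
    fix y
    have "{r. y < w r} = (\<Union>\<xi>\<in>S. {r. y < ennreal (g (r *\<^sub>R (e + \<xi>)))})"
      by (auto simp: w_def less_SUP_iff)
    moreover have "open {r. y < ennreal (g (r *\<^sub>R (e + \<xi>)))}" for \<xi>
      by (intro open_Collect_less continuous_on_ennreal continuous_on_compose2[OF g(1)] continuous_intros) auto
    ultimately show "{r \<in> space borel. y < w r} \<in> sets borel"
      by (simp add: borel_open open_UN)
  qed
  have bound: "AE \<xi> in N. ennreal (g (r *\<^sub>R (e + \<delta> k *\<^sub>R \<xi>))) \<le> w r" for k r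
    using N(3)
  proof eventually_elim
    case (elim \<xi>)
    have "\<delta> k * norm \<xi> \<le> \<delta> k * 1"
      using elim \<delta>(1)[of k] by (intro mult_left_mono) auto
    then have "\<delta> k * norm \<xi> < \<epsilon>" using \<delta>(2)[of k] by linarith
    then have "\<delta> k *\<^sub>R \<xi> \<in> S"
      using elim \<delta>(1)[of k] by (simp add: S_def)
    then show ?case unfolding w_def by (rule SUP_upper)
  qed
  have lim_inner: "(\<lambda>k. \<integral>\<^sup>+\<xi>. ennreal (g (r *\<^sub>R (e + \<delta> k *\<^sub>R \<xi>))) \<partial>N) \<longlonglongrightarrow> ennreal (g (r *\<^sub>R e)) * ennreal V"
    if "w r \<noteq> \<top>" for r
  proof -
    have "(\<lambda>k. \<integral>\<^sup>+\<xi>. ennreal (g (r *\<^sub>R (e + \<delta> k *\<^sub>R \<xi>))) \<partial>N) \<longlonglongrightarrow> (\<integral>\<^sup>+\<xi>. ennreal (g (r *\<^sub>R e)) \<partial>N)"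
    proof (rule nn_integral_dominated_convergence[where w = "\<lambda>_. w r"])
      show "(\<integral>\<^sup>+\<xi>. w r \<partial>N) < \<infinity>"
        using that by (simp add: N ennreal_mult_less_top less_top)
      show "AE \<xi> in N. (\<lambda>k. ennreal (g (r *\<^sub>R (e + \<delta> k *\<^sub>R \<xi>)))) \<longlonglongrightarrow> ennreal (g (r *\<^sub>R e))"
      proof (rule AE_I2)
        fix \<xi>
        have "(\<lambda>k. r *\<^sub>R (e + \<delta> k *\<^sub>R \<xi>)) \<longlonglongrightarrow> r *\<^sub>R (e + 0 *\<^sub>R \<xi>)"
          by (intro tendsto_intros \<delta>)
        then have "(\<lambda>k. g (r *\<^sub>R (e + \<delta> k *\<^sub>R \<xi>))) \<longlonglongrightarrow> g (r *\<^sub>R (e + 0 *\<^sub>R \<xi>))"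
          by (intro continuous_on_tendsto_compose[OF g(1)]) auto
        then show "(\<lambda>k. ennreal (g (r *\<^sub>R (e + \<delta> k *\<^sub>R \<xi>)))) \<longlonglongrightarrow> ennreal (g (r *\<^sub>R e))"
          by (intro tendsto_ennrealI) simp
      qed
    qed (use bound in auto)
    then show ?thesis by (simp add: N)
  qed
  have w_fin: "(\<integral>\<^sup>+r. ennreal (r ^ m) * w r * indicator {0..} r \<partial>lborel) < \<infinity>"
    using fin by (simp add: w_def S_def)
  have "(\<lambda>k. \<integral>\<^sup>+r\<in>{0..}. ennreal (r ^ m) * (\<integral>\<^sup>+\<xi>. ennreal (g (r *\<^sub>R (e + \<delta> k *\<^sub>R \<xi>))) \<partial>N) \<partial>lborel)
    \<longlonglongrightarrow> (\<integral>\<^sup>+r\<in>{0..}. ennreal (r ^ m) * (ennreal (g (r *\<^sub>R e)) * ennreal V) \<partial>lborel)"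
  proof (rule nn_integral_dominated_convergence[where w = "\<lambda>r. ennreal V * (ennreal (r ^ m) * w r * indicator {0..} r)"])
    show "(\<integral>\<^sup>+r. ennreal V * (ennreal (r ^ m) * w r * indicator {0..} r) \<partial>lborel) < \<infinity>"
      using w_fin by (subst nn_integral_cmult) (auto simp: ennreal_mult_less_top)
    show "AE r in lborel. ennreal (r ^ m) * (\<integral>\<^sup>+\<xi>. ennreal (g (r *\<^sub>R (e + \<delta> k *\<^sub>R \<xi>))) \<partial>N) * indicator {0..} r
      \<le> ennreal V * (ennreal (r ^ m) * w r * indicator {0..} r)" for k
    proof (rule AE_I2)
      fix r
      have "(\<integral>\<^sup>+\<xi>. ennreal (g (r *\<^sub>R (e + \<delta> k *\<^sub>R \<xi>))) \<partial>N) \<le> (\<integral>\<^sup>+\<xi>. w r \<partial>N)"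
        by (rule nn_integral_mono_AE) (rule bound)
      then have "(\<integral>\<^sup>+\<xi>. ennreal (g (r *\<^sub>R (e + \<delta> k *\<^sub>R \<xi>))) \<partial>N) \<le> w r * ennreal V"
        by (simp add: N)
      then have "ennreal (r ^ m) * (\<integral>\<^sup>+\<xi>. ennreal (g (r *\<^sub>R (e + \<delta> k *\<^sub>R \<xi>))) \<partial>N) * indicator {0..} r
        \<le> ennreal (r ^ m) * (w r * ennreal V) * indicator {0..} r"
        by (intro mult_right_mono mult_left_mono) auto
      then show "ennreal (r ^ m) * (\<integral>\<^sup>+\<xi>. ennreal (g (r *\<^sub>R (e + \<delta> k *\<^sub>R \<xi>))) \<partial>N) * indicator {0..} r
        \<le> ennreal V * (ennreal (r ^ m) * w r * indicator {0..} r)"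
        by (simp only: ac_simps)
    qed
    \<comment> \<open>An integrable bound is finite almost everywhere; for \<open>r > 0\<close> the
      positive factor \<open>r ^ m\<close> can be removed, so \<open>w r\<close> is finite and the
      inner limit is available.\<close>
    have "AE r in lborel. ennreal (r ^ m) * w r * indicator {0..} r \<noteq> \<infinity>"
      using w_fin by (intro nn_integral_PInf_AE) auto
    then show "AE r in lborel. (\<lambda>k. ennreal (r ^ m) * (\<integral>\<^sup>+\<xi>. ennreal (g (r *\<^sub>R (e + \<delta> k *\<^sub>R \<xi>))) \<partial>N) * indicator {0..} r)
      \<longlonglongrightarrow> ennreal (r ^ m) * (ennreal (g (r *\<^sub>R e)) * ennreal V) * indicator {0..} r"
    proof eventually_elim
      case (elim r)
      show ?case
      proof (cases "r > 0")
        case True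
        then have "ennreal (r ^ m) \<noteq> 0" by simp
        then have "w r \<noteq> \<top>" using elim True by (auto simp: ennreal_mult_eq_top_iff)
        from lim_inner[OF this] True show ?thesis
          by (auto intro!: ennreal_tendsto_cmult)
      next
        \<comment> \<open>For \<open>r = 0\<close> the power vanishes since \<open>m > 0\<close>,
          and for negative \<open>r\<close> the indicator does.\<close>
        case False
        then show ?thesis using \<open>m > 0\<close> by (auto simp: indicator_def power_0_left)
      qed
    qed
  qed measurable
  also have "(\<integral>\<^sup>+r\<in>{0..}. ennreal (r ^ m) * (ennreal (g (r *\<^sub>R e)) * ennreal V) \<partial>lborel)
    = (\<integral>\<^sup>+r. ennreal V * (ennreal (r ^ m * g (r *\<^sub>R e)) * indicator {0..} r) \<partial>lborel)"
    by (intro nn_integral_cong) (auto simp: indicator_def ennreal_mult g(2) ac_simps)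
  also have "\<dots> = ennreal V * (\<integral>\<^sup>+r\<in>{0..}. ennreal (r ^ m * g (r *\<^sub>R e)) \<partial>lborel)"
    by (intro nn_integral_cmult) measurable
  finally show "(\<lambda>k. \<integral>\<^sup>+r\<in>{0..}. ennreal (r ^ m) * (\<integral>\<^sup>+\<xi>. ennreal (g (r *\<^sub>R (e + \<delta> k *\<^sub>R \<xi>))) \<partial>N) \<partial>lborel)
    \<longlonglongrightarrow> ennreal V * (\<integral>\<^sup>+r\<in>{0..}. ennreal (r ^ m * g (r *\<^sub>R e)) \<partial>lborel)" .
qed

text \<open>By continuity \<open>g\<close> stays positive along the ray near \<open>x\<close>. The
  interval is taken to the right of \<open>x\<close>, so that \<open>r > 0\<close> and hence
  \<open>r ^ m > 0\<close> even when \<open>x = 0\<close>; a zero integral would make this interval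
  a null set.\<close>

lemma nn_integral_ray_pos:
  fixes e :: "'a::euclidean_space" and g :: "'a \<Rightarrow> real"
  assumes g: "continuous_on UNIV g" and x: "x \<ge> 0" "g (x *\<^sub>R e) > 0"
  shows "(\<integral>\<^sup>+r\<in>{0..}. ennreal (r ^ m * g (r *\<^sub>R e)) \<partial>lborel) > 0"
proof (rule ccontr)
  have cont: "continuous_on UNIV (\<lambda>r. g (r *\<^sub>R e))"
    by (intro continuous_on_compose2[OF g] continuous_intros) auto
  have [measurable]: "(\<lambda>r. g (r *\<^sub>R e)) \<in> borel_measurable borel"
    using cont by (rule borel_measurable_continuous_onI)
  assume "\<not> ?thesis"
  then have "(\<integral>\<^sup>+r\<in>{0..}. ennreal (r ^ m * g (r *\<^sub>R e)) \<partial>lborel) = 0"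
    by (simp add: not_less)
  then have AE: "AE r in lborel. ennreal (r ^ m * g (r *\<^sub>R e)) * indicator {0..} r = 0"
    by (subst (asm) nn_integral_0_iff_AE) auto
  have "open {r. 0 < g (r *\<^sub>R e)}"
    by (intro open_Collect_less cont continuous_intros)
  with x obtain d where d: "d > 0" "ball x d \<subseteq> {r. 0 < g (r *\<^sub>R e)}"
    by (auto simp: open_contains_ball)
  have "AE r in lborel. r \<notin> {x<..<x + d}"
    using AE
  proof eventually_elim
    case (elim r)
    show ?case
    proof
      assume r: "r \<in> {x<..<x + d}"
      then have "r \<in> ball x d" by (auto simp: dist_real_def)
      then have "g (r *\<^sub>R e) > 0" using d by auto
      then have "r ^ m * g (r *\<^sub>R e) > 0" using r x by simp
      then show False using elim r x by (simp add: ennreal_eq_0_iff)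
    qed
  qed
  then have "emeasure lborel {x<..<x + d} = 0"
    by (subst (asm) AE_iff_measurable[where N = "{x<..<x + d}"]) auto
  then show False using d(1) by simp
qed

section \<open>Convergence of the tail ratio\<close>

theorem theorem2p1:
  fixes M :: "'a measure" and X :: "'a \<Rightarrow> real ^ 'n" and g :: "real ^ 'n \<Rightarrow> real"
  assumes "CARD('n) \<ge> 2"
    and "prob_space M"
    and "\<And>x. g x \<ge> 0"
    and "distributed M lborel X (\<lambda>x. ennreal (g x))"
    and "continuous_on UNIV g"
    and "\<exists>x\<ge>0. g (x *\<^sub>R diag_unit) > 0"
    and "\<exists>\<epsilon>>0. (\<integral>\<^sup>+ r \<in> {0..}. ennreal (r ^ (CARD('n) - 1)) *
            (SUP \<xi> \<in> {\<xi> \<in> diag_line\<^sup>\<bottom>. norm \<xi> < \<epsilon>}. ennreal (g (r *\<^sub>R (diag_unit + \<xi>))))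
          \<partial>lborel) < \<infinity>"
  shows "(\<lambda>u. \<P>(\<omega> in M. t_statistic (X \<omega>) > u) / student_t_tail (real CARD('n) - 1) u
              - enn2real (K_const g)) \<in> o[at_top](\<lambda>_. 1)
         \<and> 0 < K_const g \<and> K_const g < \<infinity>"
proof -
  define e :: "real ^ 'n" where "e = diag_unit"
  define m where "m = CARD('n) - 1"
  define \<nu> where "\<nu> = real m"
  have m: "m > 0" and \<nu>: "\<nu> > 0" "real CARD('n) - 1 = \<nu>" "real CARD('n) = \<nu> + 1"
    using assms(1) by (auto simp: m_def \<nu>_def)
  \<comment> \<open>\<open>C\<close> is the surface area of the unit sphere in dimension
    \<open>\<nu> + 1\<close>; \<open>A\<close> is the limit of \<open>u powr \<nu>\<close> times the
    Student tail.\<close>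
  define C where "C = 2 * pi powr ((\<nu> + 1) / 2) / Gamma ((\<nu> + 1) / 2)"
  define A where "A = Gamma ((\<nu> + 1) / 2) / (sqrt (\<nu> * pi) * Gamma (\<nu> / 2)) * \<nu> powr ((\<nu> + 1) / 2) / \<nu>"
  have C: "C > 0" and A: "A > 0"
    using \<nu>(1) by (auto simp: C_def A_def Gamma_real_pos)
  define L where "L = (\<integral>\<^sup>+r\<in>{0..}. ennreal (r ^ m * g (r *\<^sub>R e)) \<partial>lborel)"
  have K: "K_const g = ennreal C * L"
    by (simp add: K_const_def C_def L_def m_def e_def \<nu>(3))
  have [measurable]: "g \<in> borel_measurable borel"
    using assms(5) by (rule borel_measurable_continuous_onI)
  obtain \<epsilon> where \<epsilon>: "\<epsilon> > 0"
    and fin: "(\<integral>\<^sup>+r\<in>{0..}. ennreal (r ^ m) *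
      (SUP \<xi>\<in>{\<xi>. e \<bullet> \<xi> = 0 \<and> norm \<xi> < \<epsilon>}. ennreal (g (r *\<^sub>R (e + \<xi>)))) \<partial>lborel) < \<infinity>"
    using assms(7) by (auto simp: orthogonal_comp_diag_line e_def m_def)
  have "L > 0"
    unfolding L_def using assms(5,6) nn_integral_ray_pos by (auto simp: e_def)
  \<comment> \<open>Finiteness of the constant: \<open>\<xi> = 0\<close> is one of the points of the
    supremum in \<open>fin\<close>.\<close>
  have "L \<le> (\<integral>\<^sup>+r\<in>{0..}. ennreal (r ^ m) *
      (SUP \<xi>\<in>{\<xi>. e \<bullet> \<xi> = 0 \<and> norm \<xi> < \<epsilon>}. ennreal (g (r *\<^sub>R (e + \<xi>)))) \<partial>lborel)"
    unfolding L_def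
  proof (rule nn_integral_mono)
    fix r :: real
    have "ennreal (g (r *\<^sub>R e)) \<le> (SUP \<xi>\<in>{\<xi>. e \<bullet> \<xi> = 0 \<and> norm \<xi> < \<epsilon>}. ennreal (g (r *\<^sub>R (e + \<xi>))))"
      using \<epsilon> by (intro SUP_upper2[of 0]) auto
    then show "ennreal (r ^ m * g (r *\<^sub>R e)) * indicator {0..} r \<le> ennreal (r ^ m) *
      (SUP \<xi>\<in>{\<xi>. e \<bullet> \<xi> = 0 \<and> norm \<xi> < \<epsilon>}. ennreal (g (r *\<^sub>R (e + \<xi>)))) * indicator {0..} r"
      by (auto simp: indicator_def ennreal_mult assms(3) intro!: mult_left_mono)
  qed
  also have "\<dots> < \<infinity>" by (rule fin)
  finally have "L < \<infinity>" .
  then obtain l where l: "L = ennreal l" "l > 0"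
    using \<open>L > 0\<close> by (cases L) auto
  obtain N :: "(real ^ 'n) measure" where N: "sets N = sets borel"
    "emeasure N UNIV = ennreal (unit_ball_vol \<nu>)" "AE \<xi> in N. e \<bullet> \<xi> = 0 \<and> norm \<xi> < 1"
    and cone: "\<And>f \<delta>. f \<in> borel_measurable borel \<Longrightarrow> \<delta> > 0 \<Longrightarrow>
      (\<integral>\<^sup>+x. f x * indicator {x. 0 < x \<bullet> e \<and> x - (x \<bullet> e) *\<^sub>R e \<noteq> 0 \<and> norm (x - (x \<bullet> e) *\<^sub>R e) < \<delta> * (x \<bullet> e)} x \<partial>lborel)
      = ennreal (\<delta> ^ m) *
        (\<integral>\<^sup>+r\<in>{0..}. ennreal (r ^ m) * (\<integral>\<^sup>+\<xi>. f (r *\<^sub>R (e + \<delta> *\<^sub>R \<xi>)) \<partial>N) \<partial>lborel)"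
    using cone_nn_integral[of e] assms(1) unfolding \<nu>_def m_def e_def norm_diag_unit by blast
  define F where "F \<delta> = (\<integral>\<^sup>+r\<in>{0..}. ennreal (r ^ m) * (\<integral>\<^sup>+\<xi>. ennreal (g (r *\<^sub>R (e + \<delta> *\<^sub>R \<xi>))) \<partial>N) \<partial>lborel)" for \<delta>
  \<comment> \<open>The event is the preimage of the cone of opening
    \<open>\<delta> = sqrt \<nu> / u\<close>, so the density of \<open>X\<close> and the slice
    formula give its probability exactly.\<close>
  have prob: "\<P>(\<omega> in M. t_statistic (X \<omega>) > u) = (sqrt \<nu> / u) ^ m * enn2real (F (sqrt \<nu> / u))" if u: "u > 0" for u
  proof -
    define D where "D = {x. 0 < x \<bullet> e \<and> x - (x \<bullet> e) *\<^sub>R e \<noteq> 0 \<and> norm (x - (x \<bullet> e) *\<^sub>R e) < sqrt \<nu> / u * (x \<bullet> e)}"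
    have [measurable]: "D \<in> sets borel" unfolding D_def by measurable
    have pos: "sqrt \<nu> / u > 0" using u \<nu> by simp
    have "{\<omega> \<in> space M. t_statistic (X \<omega>) > u} = X -` D \<inter> space M"
      using t_statistic_greater_iff[OF assms(1) u] by (auto simp: D_def e_def \<nu>(2))
    also have "emeasure M \<dots> = (\<integral>\<^sup>+x. ennreal (g x) * indicator D x \<partial>lborel)"
      by (rule distributed_emeasure[OF assms(4)]) simp
    also have "\<dots> = ennreal ((sqrt \<nu> / u) ^ m) * F (sqrt \<nu> / u)"
      unfolding D_def F_def by (rule cone[OF _ pos]) measurable
    finally show ?thesis
      using pos by (simp add: measure_def enn2real_mult)
  qed
  have "(F \<longlongrightarrow> ennreal (unit_ball_vol \<nu>) * L) (at_right 0)"
    unfolding F_def L_def by (rule nn_integral_cone_tendsto[OF N assms(5,3) m \<epsilon> fin])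
  then have "((\<lambda>\<delta>. enn2real (F \<delta>)) \<longlongrightarrow> unit_ball_vol \<nu> * l) (at_right 0)"
    using \<nu>(1) l by (intro tendsto_enn2real) (auto simp: ennreal_mult)
  moreover have "filterlim (\<lambda>u. sqrt \<nu> / u) (at_right 0) at_top"
    using \<nu>(1) by (intro filterlim_at_withinI) 
      (auto intro!: tendsto_divide_0[OF tendsto_const] filterlim_at_top_imp_at_infinity filterlim_ident
        eventually_mono[OF eventually_gt_at_top[of 0]])
  ultimately have "((\<lambda>u. enn2real (F (sqrt \<nu> / u))) \<longlongrightarrow> unit_ball_vol \<nu> * l) at_top"
    by (rule filterlim_compose)
  \<comment> \<open>Numerator and denominator of the ratio are both multiplied by
    \<open>u powr \<nu>\<close>; each then has a finite limit, and the limit \<open>A\<close> of the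
    denominator is nonzero.\<close>
  from tendsto_divide[OF tendsto_mult[OF tendsto_const this] student_t_tail_asymp[OF \<nu>(1), folded A_def]]
  have "((\<lambda>u. sqrt \<nu> powr \<nu> * enn2real (F (sqrt \<nu> / u)) / (u powr \<nu> * student_t_tail \<nu> u))
    \<longlongrightarrow> sqrt \<nu> powr \<nu> * (unit_ball_vol \<nu> * l) / A) at_top"
    using A by simp
  moreover have "sqrt \<nu> powr \<nu> * (unit_ball_vol \<nu> * l) / A = C * l"
    using student_t_tail_constant[OF \<nu>(1), folded A_def C_def] A
    by (simp flip: mult.assoc)
  moreover have "C * l = enn2real (K_const g)"
    using C l by (simp add: K enn2real_mult)
  \<comment> \<open>For positive \<open>u\<close> the real powers agree with the natural powers
    \<open>^ m\<close> in \<open>prob\<close>, so the rescaled quotient is the original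
    ratio.\<close>
  moreover have "sqrt \<nu> powr \<nu> * enn2real (F (sqrt \<nu> / u)) / (u powr \<nu> * student_t_tail \<nu> u)
    = \<P>(\<omega> in M. t_statistic (X \<omega>) > u) / student_t_tail \<nu> u" if "u > 0" for u
    using that \<nu>(1) by (simp add: prob \<nu>_def powr_realpow power_divide)
  ultimately have "((\<lambda>u. \<P>(\<omega> in M. t_statistic (X \<omega>) > u) / student_t_tail \<nu> u) \<longlongrightarrow> enn2real (K_const g)) at_top"
    by (auto elim!: Lim_transform_eventually intro: eventually_mono[OF eventually_gt_at_top[of 0]])
  then have "(\<lambda>u. \<P>(\<omega> in M. t_statistic (X \<omega>) > u) / student_t_tail \<nu> u - enn2real (K_const g)) \<in> o[at_top](\<lambda>_. 1)"
    by (intro smalloI_tendsto) (auto simp: LIM_zero)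
  moreover have "0 < K_const g" "K_const g < \<infinity>"
    using C l by (auto simp: K ennreal_zero_less_mult_iff ennreal_mult_less_top)
  ultimately show ?thesis by (simp add: \<nu>(2))
qed

end
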